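(* Let $h:\mathbb{R}^d\to[K]=\{1,\dots,K\}$ be a classifier that is scale-invariant: $h(\lambda x)=h(x)$ for all $\lambda>0$ and $x\in\mathbb{R}^d$. Let $\beta(t)=\beta_{\min}+(\beta_{\max}-\beta_{\min})t$, $t\in[0,1]$, with $0<\beta_{\min}<\beta_{\max}$, and $\alpha(t)=\exp\left(-\int_0^t\beta(s)\,ds\right)$. Let $x,\epsilon_{\mathrm{adv}}\in\mathbb{R}^d$, $x_{\mathrm{adv}}=x+\epsilon_{\mathrm{adv}}$, and for $t\in[0,1]$ let $$x(t)=\sqrt{\alpha(t)}\,x_{\mathrm{adv}}+\sqrt{1-\alpha(t)}\,\epsilon,\qquad \epsilon\sim\mathcal{N}(0,I_d).$$ Suppose there exist $\underline{p_1},\overline{p_2}\in(0,1)$ and $k_1\in[K]$ such that for all $t\in[0,1]$, $$\mathbb{P}\big(h(x+\epsilon'(t))=k_1\big)\ \ge\ \underline{p_1}\ >\ \overline{p_2}\ \ge\ \max_{k\ne k_1}\mathbb{P}\big(h(x+\epsilon'(t))=k\big),$$ where $\epsilon'(t)\sim\mathcal{N}\left(0,\frac{1-\alpha(t)}{\alpha(t)}I_d\right)$. Define $$M:=\log\left(1+\left(\frac{2\|\epsilon_{\mathrm{adv}}\|_2}{\Phi^{-1}(\underline{p_1})-\Phi^{-1}(\overline{p_2})}\right)^2\right),\qquad t_{\min}=\frac{2M}{\sqrt{\beta_{\min}^2+2(\beta_{\max}-\beta_{\min})M}+\beta_{\min}}.$$ If $\beta_{\min}\ge M$, then for all $t$ with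 $t_{\min}\le t\le 1$, $$\arg\max_{k\in[K]}\ \mathbb{P}\big(h(x(t))=k\big)=k_1.$$
   Context: $\Phi^{-1}$ is the inverse of the standard normal cumulative distribution function. The classifier $h$ is a (measurable) deterministic function. For $t=0$ one has $\alpha(0)=1$, and $\epsilon'(0)$ is the degenerate Gaussian, identically $0$. The process $x(t)$ is given by its closed-form marginal: it is the solution at time $t$ of the variance-preserving SDE $dx(t)=-\tfrac12\beta(t)x(t)\,dt+\sqrt{\beta(t)}\,dw(t)$, $x(0)=x_{\mathrm{adv}}$; only the marginal law at each $t$ matters for the claim. *)

theory Defs
  imports "HOL-Probability.Probability"
begin

definition std_normal_cdf :: "real \<Rightarrow> real"  (\<open>\<Phi>\<close>)
  where "\<Phi> = cdf std_normal_distribution"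

text \<open>Meaningful on the open unit interval, where \<open>\<Phi>\<close> has exactly one preimage.\<close>
definition std_normal_quantile :: "real \<Rightarrow> real"
  where "std_normal_quantile = the_inv \<Phi>"

definition std_multi_normal :: "(real ^ 'n) measure"
  where "std_multi_normal =
    density lborel (\<lambda>z. ennreal (exp (- (norm z)\<^sup>2 / 2) / sqrt (2 * pi) ^ CARD('n)))"

text \<open>The normal law with mean \<open>m\<close> and covariance matrix \<open>v\<close> times the identity, for
  \<open>v \<ge> 0\<close>. Defining it as an image measure includes the degenerate case \<open>v = 0\<close>, the point
  mass at \<open>m\<close>, which has no density.\<close>
definition isotropic_normal :: "real ^ 'n \<Rightarrow> real \<Rightarrow> (real ^ 'n) measure"
  where "isotropic_normal m v = distr std_multi_normal borel (\<lambda>z. m + sqrt v *\<^sub>R z)"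

end

theory Submission imports Defs
begin

text \<open>Scale invariance reduces the claim to noise of standard deviation
  \<open>\<sigma> t = sqrt ((1 - \<alpha> t) / \<alpha> t)\<close> added to \<open>x\<^sub>a\<^sub>d\<^sub>v\<close>, and \<open>t \<ge> t\<^sub>m\<^sub>i\<^sub>n\<close> says exactly that
  \<open>norm \<epsilon>\<^sub>a\<^sub>d\<^sub>v\<close> is at most the Neyman-Pearson radius \<open>\<sigma> t * (\<Phi>\<^sup>-\<^sup>1 p\<^sub>1 - \<Phi>\<^sup>-\<^sup>1 p\<^sub>2) / 2\<close>. At
  \<open>t = t\<^sub>m\<^sub>i\<^sub>n\<close> the radius is attained and Neyman-Pearson alone does not exclude a tie; but a tie would
  force both classes to be half-spaces, and the hypothesis at time \<open>1 > t\<^sub>m\<^sub>i\<^sub>n\<close>, where the noise is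
  larger, rules that out.\<close>

section \<open>The standard Gaussian on \<open>real ^ 'n\<close> and its one-dimensional
  projections\<close>

lemma std_multi_normal_density_eq_prod:
  fixes z :: "real ^ 'n"
  shows "exp (- (norm z)\<^sup>2 / 2) / sqrt (2 * pi) ^ CARD('n) = (\<Prod>b\<in>Basis. std_normal_density (z \<bullet> b))"
proof -
  have "(\<Prod>b\<in>Basis. std_normal_density (z \<bullet> b)) = (\<Prod>b\<in>(Basis::(real^'n) set). 1 / sqrt (2 * pi)) * exp (\<Sum>b\<in>Basis. - (z \<bullet> b)\<^sup>2 / 2)"
    unfolding std_normal_density_def prod.distrib by (simp add: exp_sum)
  also have "(\<Sum>b\<in>Basis. - (z \<bullet> b)\<^sup>2 / 2) = - (norm z)\<^sup>2 / 2"
    by (simp add: sum_negf sum_divide_distrib[symmetric] power2_norm_eq_inner euclidean_inner[of z z] flip: power2_eq_square)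
  finally show ?thesis by (simp add: power_divide)
qed

lemma sets_std_multi_normal [simp, measurable_cong]: "sets std_multi_normal = sets borel"
  and space_std_multi_normal [simp]: "space std_multi_normal = UNIV"
  by (simp_all add: std_multi_normal_def)

lemma prob_space_std_multi_normal: "prob_space (std_multi_normal :: (real ^ 'n) measure)"
proof
  have "emeasure (std_multi_normal :: (real ^ 'n) measure) (space std_multi_normal) =
      (\<integral>\<^sup>+z. (\<Prod>b\<in>(Basis::(real^'n) set). ennreal (std_normal_density (z \<bullet> b))) \<partial>lborel)"
    unfolding std_multi_normal_def std_multi_normal_density_eq_prod
    by (simp add: emeasure_density prod_ennreal)
  also have "\<dots> = (\<Prod>b\<in>(Basis::(real^'n) set). \<integral>\<^sup>+y. ennreal (std_normal_density y) \<partial>lborel)"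
    by (intro nn_integral_lborel_prod) auto
  also have "(\<integral>\<^sup>+y. ennreal (std_normal_density y) \<partial>lborel) = 1"
    using prob_space.emeasure_space_1[OF prob_space_normal_density[of 1 0]] by (simp add: emeasure_density)
  finally show "emeasure (std_multi_normal :: (real ^ 'n) measure) (space std_multi_normal) = 1"
    by simp
qed

interpretation std_multi_normal: prob_space "std_multi_normal :: (real ^ 'n) measure"
  by (rule prob_space_std_multi_normal)

interpretation std_normal: real_distribution std_normal_distribution
  by (rule real_dist_normal_dist)

text \<open>Density and exponential both factor over the coordinates, so Fubini leaves a product of
  one-dimensional characteristic functions. By Levy uniqueness this determines the law of every
  linear functional, and hence the probability of every half-space.\<close>

lemma char_inner_std_multi_normal:
  fixes d :: "real ^ 'n"
  shows "char (distr std_multi_normal borel (\<lambda>z. d \<bullet> z)) t = exp (- (t * norm d)\<^sup>2 / 2)"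
proof -
  interpret P: product_sigma_finite "\<lambda>b::real^'n. lborel :: real measure" ..
  let ?g = "\<lambda>b y. complex_of_real (std_normal_density y) * iexp (t * (d \<bullet> b) * y)"
  have int: "integrable lborel (?g b)" for b
    by (intro Bochner_Integration.integrable_bound[OF integrable_normal_density[of 1 0]]) (auto simp: norm_mult)
  have one: "integral\<^sup>L lborel (?g b) = exp (- (t * (d \<bullet> b))\<^sup>2 / 2)" for b
    using char_std_normal_distribution[THEN fun_cong, of "t * (d \<bullet> b)"]
    by (simp add: char_def integral_density scaleR_conv_of_real)
  have eq: "(\<Prod>b\<in>(Basis :: (real^'n) set). ?g b (z \<bullet> b))
     = complex_of_real (exp (- (norm z)\<^sup>2 / 2) / sqrt (2 * pi) ^ CARD('n)) * iexp (t * (d \<bullet> z))" for z :: "real^'n"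
    unfolding std_multi_normal_density_eq_prod
    by (simp add: prod.distrib exp_sum[symmetric] sum_distrib_left[symmetric] euclidean_inner[of d z] mult.assoc
        del: of_real_prod of_real_sum of_real_mult flip: of_real_prod of_real_sum of_real_mult)
  have "char (distr std_multi_normal borel (\<lambda>z. d \<bullet> z)) t =
      (\<integral>z. (\<Prod>b\<in>Basis. ?g b (z \<bullet> b)) \<partial>(lborel :: (real^'n) measure))"
    unfolding eq
    by (simp add: char_def integral_distr std_multi_normal_def integral_density scaleR_conv_of_real)
  also have "\<dots> = (\<integral>f. (\<Prod>b\<in>Basis. ?g b (f b)) \<partial>(\<Pi>\<^sub>M b\<in>(Basis :: (real^'n) set). lborel))"
    by (subst lborel_eq, subst integral_distr) (auto intro!: Bochner_Integration.integral_cong prod.cong)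
  also have "\<dots> = (\<Prod>b\<in>(Basis :: (real^'n) set). integral\<^sup>L lborel (?g b))"
    by (intro P.product_integral_prod int) auto
  also have "\<dots> = (\<Prod>b\<in>(Basis :: (real^'n) set). exp (- (t * (d \<bullet> b))\<^sup>2 / 2))"
    unfolding one by simp
  also have "\<dots> = exp (- (t * norm d)\<^sup>2 / 2)"
    by (simp add: exp_sum[symmetric] sum_negf sum_divide_distrib[symmetric] sum_distrib_left[symmetric] power_mult_distrib
       power2_norm_eq_inner euclidean_inner[of d d]) (simp add: power2_eq_square)
  finally show ?thesis .
qed

lemma distr_inner_std_multi_normal:
  fixes d :: "real ^ 'n"
  assumes "norm d = 1"
  shows "distr std_multi_normal borel (\<lambda>z. d \<bullet> z) = std_normal_distribution"
  using assms
  by (intro Levy_uniqueness ext real_dist_normal_dist std_multi_normal.real_distribution_distr)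
     (auto simp: char_inner_std_multi_normal char_std_normal_distribution)

lemma measure_halfspace_std_multi_normal:
  fixes d :: "real ^ 'n"
  assumes "d \<noteq> 0"
  shows "measure std_multi_normal {z. d \<bullet> z \<le> s * norm d} = \<Phi> s"
proof -
  let ?e = "d /\<^sub>R norm d"
  have "\<Phi> s = measure (distr std_multi_normal borel (\<lambda>z. ?e \<bullet> z)) {..s}"
    using assms by (subst distr_inner_std_multi_normal) (auto simp: std_normal_cdf_def cdf_def)
  also have "\<dots> = measure std_multi_normal {z. d \<bullet> z \<le> s * norm d}"
    using assms by (subst measure_distr) (auto simp: vimage_def field_simps)
  finally show ?thesis by simp
qed

lemma AE_not_hyperplane_std_multi_normal:
  fixes d :: "real ^ 'n"
  assumes "d \<noteq> 0"
  shows "AE z in std_multi_normal. d \<bullet> z \<noteq> s"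
proof -
  let ?e = "d /\<^sub>R norm d"
  have "AE y in std_normal_distribution. y \<noteq> s / norm d"
    using AE_lborel_singleton[of "s / norm d"] by (subst AE_density) auto
  then have "AE y in distr std_multi_normal borel (\<lambda>z. ?e \<bullet> z). y \<noteq> s / norm d"
    using assms by (subst distr_inner_std_multi_normal) auto
  then show ?thesis
    using assms by (subst (asm) AE_distr_iff) (auto simp: field_simps)
qed

section \<open>The normal distribution function and its quantile\<close>

lemma strict_mono_std_normal_cdf: "strict_mono \<Phi>"
proof
  fix a b :: real assume ab: "a < b"
  \<comment> \<open>The density is positive everywhere, so a Gaussian null set is Lebesgue null,
    which an interval of positive length is not.\<close>
  have "{a<..b} \<notin> null_sets std_normal_distribution"
  proof
    assume "{a<..b} \<in> null_sets std_normal_distribution"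
    then have "AE y in lborel. y \<notin> {a<..b}"
      by (auto simp: null_sets_density_iff elim!: eventually_mono)
        (metis ennreal_less_zero_iff normal_density_pos not_less_iff_gr_or_eq zero_less_one)
    then have "{y. a < y \<and> y \<le> b} \<in> null_sets lborel"
      by (subst (asm) AE_iff_null) auto
    then have "emeasure lborel {a<..b} = 0"
      by (simp add: null_sets_def greaterThanAtMost_def greaterThan_def atMost_def Collect_conj_eq)
    with ab show False by simp
  qed
  then have "measure std_normal_distribution {a<..b} > 0"
    by (auto simp: null_sets_def std_normal.emeasure_eq_measure zero_less_measure_iff)
  then show "\<Phi> a < \<Phi> b"
    using std_normal.cdf_diff_eq[OF ab] by (simp add: std_normal_cdf_def)
qed

text \<open>Opposite half-spaces in \<open>real ^ 1\<close> have complementary probabilities up to a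
  null hyperplane, and the half-space formula does not depend on the direction of the normal
  vector.\<close>

lemma std_normal_cdf_minus: "\<Phi> (- s) = 1 - \<Phi> s"
proof -
  let ?d = "axis 1 1 :: real ^ 1"
  have d: "?d \<noteq> 0" "norm ?d = 1" by auto
  have "\<Phi> (- s) = measure std_multi_normal {z. ?d \<bullet> z \<le> - s}"
    using measure_halfspace_std_multi_normal[OF d(1), of "- s"] d(2) by simp
  also have "\<dots> = measure std_multi_normal (space std_multi_normal - {z. - ?d \<bullet> z \<le> s})"
    using AE_not_hyperplane_std_multi_normal[OF d(1), of "- s"]
    by (intro std_multi_normal.finite_measure_eq_AE) (auto elim!: eventually_mono)
  also have "\<dots> = 1 - measure std_multi_normal {z. - ?d \<bullet> z \<le> s}"
    by (rule std_multi_normal.prob_compl) auto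
  also have "measure std_multi_normal {z. - ?d \<bullet> z \<le> s} = \<Phi> s"
    using measure_halfspace_std_multi_normal[of "- ?d" s] d by simp
  finally show ?thesis .
qed

text \<open>There are no atoms, so \<Phi> is continuous, and its limits 0 and 1 give a preimage by
  the intermediate value theorem. Strict monotonicity makes it unique, so \<open>the_inv\<close> is
  a genuine inverse here.\<close>

lemma std_normal_cdf_quantile:
  assumes "p \<in> {0<..<1}"
  shows "\<Phi> (std_normal_quantile p) = p"
proof -
  have "isCont \<Phi> y" for y
  proof -
    have "AE x in lborel. x \<in> {y} \<longrightarrow> ennreal (std_normal_density x) = 0"
      using AE_lborel_singleton[of y] by eventually_elim simp
    then have "{y} \<in> null_sets std_normal_distribution"
      by (subst null_sets_density_iff) auto
    then show ?thesis
      by (auto simp: std_normal_cdf_def std_normal.isCont_cdf null_sets_def measure_def)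
  qed
  moreover have "eventually (\<lambda>y. \<Phi> y < p) at_bot" "eventually (\<lambda>y. \<Phi> y > p) at_top"
    using assms order_tendstoD[OF std_normal.cdf_lim_at_bot] order_tendstoD[OF std_normal.cdf_lim_at_top_prob]
    by (auto simp: std_normal_cdf_def)
  then obtain a b where "\<And>y. y \<le> a \<Longrightarrow> \<Phi> y < p" "\<And>y. y \<ge> b \<Longrightarrow> \<Phi> y > p"
    unfolding eventually_at_bot_linorder eventually_at_top_linorder by blast
  then have "\<Phi> (min a b) < p" "\<Phi> (max a b) > p" "min a b \<le> max a b" by auto
  ultimately obtain y where "\<Phi> y = p"
    using IVT[of \<Phi> "min a b" p "max a b"] by (auto simp: less_imp_le)
  moreover have "inj \<Phi>"
    using strict_mono_std_normal_cdf by (rule strict_mono_imp_inj_on)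
  ultimately show ?thesis
    unfolding std_normal_quantile_def by (auto simp: the_inv_f_f)
qed

section \<open>Translated Gaussians and the Neyman-Pearson bound\<close>

text \<open>The finite-dimensional Cameron-Martin formula: expanding the square of
  \<open>norm (z - d)\<close> in the density leaves an exponential of a function affine in
  \<open>z\<close>.\<close>

lemma distr_translation_std_multi_normal:
  fixes d :: "real ^ 'n"
  shows "distr std_multi_normal borel ((+) d) =
    density std_multi_normal (\<lambda>z. ennreal (exp (d \<bullet> z - (norm d)\<^sup>2 / 2)))"
proof (rule measure_eqI)
  fix A assume "A \<in> sets (distr std_multi_normal borel ((+) d))"
  then have A [measurable]: "A \<in> sets borel" by simp
  let ?f = "\<lambda>z :: real ^ 'n. exp (- (norm z)\<^sup>2 / 2) / sqrt (2 * pi) ^ CARD('n)"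
  have f: "ennreal (?f (z - d)) = ennreal (?f z) * ennreal (exp (d \<bullet> z - (norm d)\<^sup>2 / 2))" for z
    by (simp add: ennreal_mult'[symmetric] exp_add[symmetric] power2_norm_eq_inner inner_diff inner_commute field_simps)
  have "(+) d -` A \<in> sets borel"
    by (rule measurable_sets_borel[OF _ A]) measurable
  then have "emeasure (distr std_multi_normal borel ((+) d)) A =
      (\<integral>\<^sup>+z. ennreal (?f z) * indicator A (d + z) \<partial>lborel)"
    by (simp add: emeasure_distr) (simp add: std_multi_normal_def emeasure_density
        flip: indicator_vimage)
  also have "\<dots> = (\<integral>\<^sup>+z. ennreal (?f (z - d)) * indicator A z \<partial>distr lborel borel ((+) d))"
    by (subst nn_integral_distr) auto
  also have "\<dots> = emeasure (density std_multi_normal (\<lambda>z. ennreal (exp (d \<bullet> z - (norm d)\<^sup>2 / 2)))) A"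
    unfolding lborel_distr_plus f
    by (simp add: std_multi_normal_def emeasure_density nn_integral_density mult.assoc)
  finally show "emeasure (distr std_multi_normal borel ((+) d)) A =
      emeasure (density std_multi_normal (\<lambda>z. ennreal (exp (d \<bullet> z - (norm d)\<^sup>2 / 2)))) A" .
qed simp

text \<open>The likelihood ratio increases with \<open>d \<bullet> z\<close>, so among sets of given
  Gaussian probability a half-space \<open>d \<bullet> z \<le> const\<close> loses the most mass
  under the shift. The second claim is the uniqueness of this minimizer up to null sets.\<close>

lemma neyman_pearson_translation:
  fixes d :: "real ^ 'n"
  assumes A [measurable]: "A \<in> sets borel" and d: "d \<noteq> 0"
    and q: "\<Phi> q \<le> measure std_multi_normal A"
  shows "\<Phi> (q - norm d) \<le> measure std_multi_normal {z. d + z \<in> A}"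
    and "measure std_multi_normal {z. d + z \<in> A} = \<Phi> (q - norm d) \<Longrightarrow>
      AE z in std_multi_normal. z \<in> A \<longleftrightarrow> d \<bullet> z \<le> q * norm d"
proof -
  define H where "H = {z. d \<bullet> z \<le> q * norm d}"
  define L where "L z = exp (d \<bullet> z - (norm d)\<^sup>2 / 2)" for z
  \<comment> \<open>\<open>c\<close> is the value of the likelihood ratio \<open>L\<close> on the
    boundary of \<open>H\<close>. Both factors of \<open>D\<close> then never have opposite signs,
    and integrating \<open>D \<ge> 0\<close> gives the bound.\<close>
  define c where "c = exp (q * norm d - (norm d)\<^sup>2 / 2)"
  define D where "D z = (indicator A z - indicator H z) * (L z - c)" for z
  have [measurable]: "H \<in> sets borel" "L \<in> borel_measurable borel"
    unfolding H_def L_def by measurable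
  have *: "integrable std_multi_normal (\<lambda>z. indicator B z * L z)"
      "(\<integral>z. indicator B z * L z \<partial>std_multi_normal) = measure std_multi_normal {z. d + z \<in> B}"
    if [measurable]: "B \<in> sets borel" for B
  proof -
    interpret T: prob_space "distr std_multi_normal borel ((+) d)"
      by (intro std_multi_normal.prob_space_distr) auto
    have T: "distr std_multi_normal borel ((+) d) = density std_multi_normal (\<lambda>z. ennreal (L z))"
      unfolding L_def by (rule distr_translation_std_multi_normal)
    have "integrable (distr std_multi_normal borel ((+) d)) (indicator B :: _ \<Rightarrow> real)"
      by (simp add: T.emeasure_eq_measure)
    then show "integrable std_multi_normal (\<lambda>z. indicator B z * L z)"
      unfolding T by (subst (asm) integrable_density) (auto simp: L_def mult.commute)
    have "(\<integral>z. indicator B z * L z \<partial>std_multi_normal)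
        = (\<integral>z. indicator B z \<partial>distr std_multi_normal borel ((+) d))"
      unfolding T by (subst integral_density) (auto simp: L_def mult.commute)
    also have "\<dots> = measure std_multi_normal {z. d + z \<in> B}"
      by (simp add: measure_distr vimage_def)
    finally show "(\<integral>z. indicator B z * L z \<partial>std_multi_normal) = measure std_multi_normal {z. d + z \<in> B}" .
  qed
  have D_eq: "D z = indicator A z * L z - indicator H z * L z - c * (indicator A z - indicator H z)" for z
    by (simp add: D_def algebra_simps)
  have int: "integrable std_multi_normal D"
    unfolding D_eq by (intro Bochner_Integration.integrable_diff integrable_mult_right * )
      (auto simp: std_multi_normal.emeasure_eq_measure)
  have "integral\<^sup>L std_multi_normal D =
      measure std_multi_normal {z. d + z \<in> A} - measure std_multi_normal {z. d + z \<in> H}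
        - c * (measure std_multi_normal A - measure std_multi_normal H)"
    unfolding D_eq using *
    by (simp add: std_multi_normal.emeasure_eq_measure)
  also have "measure std_multi_normal H = \<Phi> q"
    unfolding H_def using d by (rule measure_halfspace_std_multi_normal)
  \<comment> \<open>Shifting by \<open>d\<close> raises \<open>d \<bullet> z\<close> by the square
    of \<open>norm d\<close>, so the normalized threshold drops by \<open>norm d\<close>.\<close>
  also have "{z. d + z \<in> H} = {z. d \<bullet> z \<le> (q - norm d) * norm d}"
    by (auto simp: H_def inner_add_right algebra_simps power2_norm_eq_inner[symmetric] power2_eq_square)
  also have "measure std_multi_normal \<dots> = \<Phi> (q - norm d)"
    using d by (rule measure_halfspace_std_multi_normal)
  finally have D_integral: "integral\<^sup>L std_multi_normal D =
      measure std_multi_normal {z. d + z \<in> A} - \<Phi> (q - norm d)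
        - c * (measure std_multi_normal A - \<Phi> q)" .
  have H_iff: "z \<in> H \<longleftrightarrow> L z \<le> c" for z
    by (simp add: H_def L_def c_def)
  have D_nonneg: "0 \<le> D z" for z
    by (auto simp: D_def indicator_def H_iff)
  have "0 \<le> integral\<^sup>L std_multi_normal D"
    by (intro integral_nonneg_AE) (simp add: D_nonneg)
  moreover have c_part: "0 \<le> c * (measure std_multi_normal A - \<Phi> q)"
    using q by (simp add: c_def)
  ultimately show "\<Phi> (q - norm d) \<le> measure std_multi_normal {z. d + z \<in> A}"
    using D_integral by linarith
  assume "measure std_multi_normal {z. d + z \<in> A} = \<Phi> (q - norm d)"
  then have "integral\<^sup>L std_multi_normal D = 0"
    using D_integral c_part \<open>0 \<le> integral\<^sup>L std_multi_normal D\<close> by linarith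
  then have "AE z in std_multi_normal. D z = 0"
    using integral_nonneg_eq_0_iff_AE[OF int] D_nonneg by simp
  then show "AE z in std_multi_normal. z \<in> A \<longleftrightarrow> d \<bullet> z \<le> q * norm d"
    using AE_not_hyperplane_std_multi_normal[OF d, of "q * norm d"]
  proof eventually_elim
    case (elim z)
    \<comment> \<open>Off the boundary hyperplane the second factor of \<open>D\<close> is nonzero,
      so the two indicators must agree.\<close>
    from elim(2) have "L z \<noteq> c" by (auto simp: L_def c_def)
    with elim(1) show ?case
      by (auto simp: D_def indicator_def H_def split: if_splits)
  qed
qed

section \<open>Null sets, cones and strict comparison of probabilities\<close>

lemma AE_std_multi_normal_iff: "(AE z in std_multi_normal. P z) \<longleftrightarrow> (AE z in lborel. P z)"
  unfolding std_multi_normal_def by (subst AE_density) auto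

text \<open>Lebesgue measure is a positive multiple of its image under the affine map. Together with
  the equivalence of Gaussian and Lebesgue null sets, this lets almost-everywhere statements be
  translated and rescaled.\<close>

lemma AE_lborel_affine:
  fixes a :: "'a::euclidean_space"
  assumes [measurable]: "Measurable.pred borel P" and "c \<noteq> 0" and P: "AE y in lborel. P y"
  shows "AE z in lborel. P (a + c *\<^sub>R z)"
proof -
  have "AE y in density (distr lborel borel (\<lambda>z. a + c *\<^sub>R z)) (\<lambda>_. \<bar>c\<bar>^DIM('a)). P y"
    using P by (subst lborel_affine[OF \<open>c \<noteq> 0\<close>, of a, symmetric])
  then have "AE y in distr lborel borel (\<lambda>z. a + c *\<^sub>R z). P y"
    using \<open>c \<noteq> 0\<close> by (subst (asm) AE_density) auto
  then show ?thesis
    by (subst (asm) AE_distr_iff) auto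
qed

text \<open>In the equality case of the Neyman-Pearson bound \<open>A\<close> is a half-space up to null sets. Being
  a cone, it has its boundary through the origin, and then pulling \<open>u\<close> towards the origin lowers
  the probability below \<open>\<Phi> q\<close>.\<close>
lemma neyman_pearson_translation_cone:
  fixes u d :: "real ^ 'n"
  assumes A [measurable]: "A \<in> sets borel" and d: "d \<noteq> 0"
    and cone: "\<And>c z. c > 0 \<Longrightarrow> c *\<^sub>R z \<in> A \<longleftrightarrow> z \<in> A"
    and u: "\<Phi> q \<le> measure std_multi_normal {z. u + z \<in> A}"
    and r: "0 < r" "r < 1" "\<Phi> q \<le> measure std_multi_normal {z. r *\<^sub>R u + z \<in> A}"
    and "0 < q"
  shows "\<Phi> (q - norm d) < measure std_multi_normal {z. u + d + z \<in> A}"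
proof (rule ccontr)
  assume "\<not> ?thesis"
  moreover have shift [measurable]: "{z. v + z \<in> A} \<in> sets borel" for v
    by measurable
  note np = neyman_pearson_translation[OF shift d u]
  moreover have "{z. d + z \<in> {z. u + z \<in> A}} = {z. u + d + z \<in> A}"
    by (simp add: add.assoc)
  ultimately have "AE z in std_multi_normal. u + z \<in> A \<longleftrightarrow> d \<bullet> z \<le> q * norm d"
    by simp
  \<comment> \<open>Undoing the shift by \<open>u\<close>, \<open>b\<close> is the signed distance
    from the origin to the boundary of the half-space that \<open>A\<close> itself equals almost
    everywhere.\<close>
  define b where "b = (d \<bullet> u) / norm d + q"
  have b: "b * norm d = d \<bullet> u + q * norm d"
    using d by (simp add: b_def field_simps)
  have half: "AE z in lborel. z \<in> A \<longleftrightarrow> d \<bullet> z \<le> b * norm d"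
    using AE_lborel_affine[of "\<lambda>z. u + z \<in> A \<longleftrightarrow> d \<bullet> z \<le> q * norm d" 1 "- u"]
      \<open>AE z in std_multi_normal. _ z\<close>
    by (simp add: AE_std_multi_normal_iff inner_diff_right b algebra_simps)
  \<comment> \<open>Doubling preserves the cone but halves the offset of the half-space. The two
    half-spaces have equal probability only if \<open>b = 0\<close>.\<close>
  have "AE z in lborel. 2 *\<^sub>R z \<in> A \<longleftrightarrow> d \<bullet> (2 *\<^sub>R z) \<le> b * norm d"
    using AE_lborel_affine[OF _ _ half, of 2 0] by simp
  with half have "AE z in std_multi_normal. d \<bullet> z \<le> b * norm d \<longleftrightarrow> d \<bullet> z \<le> b / 2 * norm d"
    unfolding AE_std_multi_normal_iff
    by eventually_elim (auto simp: cone)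
  then have "measure std_multi_normal {z. d \<bullet> z \<le> b * norm d} = measure std_multi_normal {z. d \<bullet> z \<le> b / 2 * norm d}"
    by (intro std_multi_normal.finite_measure_eq_AE) auto
  then have "\<Phi> b = \<Phi> (b / 2)"
    unfolding measure_halfspace_std_multi_normal[OF d] .
  then have "b = 0"
    using strict_mono_eq[OF strict_mono_std_normal_cdf, of b "b / 2"] by simp
  then have "d \<bullet> u = - q * norm d"
    using b by simp
  moreover have "AE z in std_multi_normal. r *\<^sub>R u + z \<in> A \<longleftrightarrow> d \<bullet> (r *\<^sub>R u + z) \<le> 0"
    using AE_lborel_affine[OF _ _ half, of 1 "r *\<^sub>R u"] \<open>b = 0\<close>
    by (simp add: AE_std_multi_normal_iff)
  \<comment> \<open>With the boundary through the origin, the threshold seen from a base point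
    scales with that point. Shrinking \<open>u\<close> by \<open>r\<close> turns \<open>q\<close>
    into the smaller \<open>r * q\<close>.\<close>
  ultimately have "AE z in std_multi_normal. r *\<^sub>R u + z \<in> A \<longleftrightarrow> d \<bullet> z \<le> (r * q) * norm d"
    by (simp add: inner_add_right algebra_simps)
  then have "measure std_multi_normal {z. r *\<^sub>R u + z \<in> A} = measure std_multi_normal {z. d \<bullet> z \<le> (r * q) * norm d}"
    by (intro std_multi_normal.finite_measure_eq_AE) auto
  with r(3) have "\<Phi> q \<le> \<Phi> (r * q)"
    by (simp only: measure_halfspace_std_multi_normal[OF d])
  then have "q \<le> r * q"
    using strict_mono_less_eq[OF strict_mono_std_normal_cdf] by simp
  with r \<open>0 < q\<close> show False
    by simp
qed

text \<open>The Neyman-Pearson bound is applied to \<open>A\<close> and to the complement of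
  \<open>B\<close>, which is again a cone and turns the upper bound for \<open>B\<close> into a
  lower one. The second alternative of \<open>margin\<close> covers
  \<open>2 * norm d = q\<^sub>1 - q\<^sub>2\<close>, where one of the two bounds has to be
  strict.\<close>

lemma cone_probability_less:
  fixes u d :: "real ^ 'n"
  assumes A [measurable]: "A \<in> sets borel" and B [measurable]: "B \<in> sets borel"
    and cone: "\<And>c z. c > 0 \<Longrightarrow> c *\<^sub>R z \<in> A \<longleftrightarrow> z \<in> A" "\<And>c z. c > 0 \<Longrightarrow> c *\<^sub>R z \<in> B \<longleftrightarrow> z \<in> B"
    and q: "q\<^sub>2 < q\<^sub>1" and d: "2 * norm d \<le> q\<^sub>1 - q\<^sub>2"
    and u: "\<Phi> q\<^sub>1 \<le> measure std_multi_normal {z. u + z \<in> A}"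
      "measure std_multi_normal {z. u + z \<in> B} \<le> \<Phi> q\<^sub>2"
    and margin: "2 * norm d < q\<^sub>1 - q\<^sub>2 \<or> 0 < r \<and> r < 1 \<and>
      \<Phi> q\<^sub>1 \<le> measure std_multi_normal {z. r *\<^sub>R u + z \<in> A} \<and>
      measure std_multi_normal {z. r *\<^sub>R u + z \<in> B} \<le> \<Phi> q\<^sub>2"
  shows "measure std_multi_normal {z. u + d + z \<in> B} < measure std_multi_normal {z. u + d + z \<in> A}"
proof (cases "d = 0")
  case True
  then show ?thesis
    using u strict_monoD[OF strict_mono_std_normal_cdf q] by simp
next
  case False
  have shift [measurable]: "{z. v + z \<in> C} \<in> sets borel" if [measurable]: "C \<in> sets borel"
    for C and v :: "real ^ 'n"
    by measurable
  have compl: "measure std_multi_normal {z. v + z \<in> - B} = 1 - measure std_multi_normal {z. v + z \<in> B}" for v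
    using std_multi_normal.prob_compl[of "{z. v + z \<in> B}"] by (simp add: Compl_eq Diff_eq)
  have B': "- B \<in> sets borel" "\<And>c z. c > 0 \<Longrightarrow> c *\<^sub>R z \<in> - B \<longleftrightarrow> z \<in> - B"
    "\<Phi> (- q\<^sub>2) \<le> measure std_multi_normal {z. u + z \<in> - B}"
    unfolding compl std_normal_cdf_minus using cone(2) u(2) by auto
  have eq: "{z. d + z \<in> {z. u + z \<in> C}} = {z. u + d + z \<in> C}" for C
    by (simp add: add.assoc)
  have a: "\<Phi> (q\<^sub>1 - norm d) \<le> measure std_multi_normal {z. u + d + z \<in> A}"
    using neyman_pearson_translation(1)[OF shift[OF A] False u(1)] by (simp only: eq)
  have b: "\<Phi> (- q\<^sub>2 - norm d) \<le> measure std_multi_normal {z. u + d + z \<in> - B}"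
    using neyman_pearson_translation(1)[OF shift[OF B'(1)] False B'(3)] by (simp only: eq)
  have ab: "\<Phi> (q\<^sub>2 + norm d) = 1 - \<Phi> (- q\<^sub>2 - norm d)"
    using std_normal_cdf_minus[of "- q\<^sub>2 - norm d"] by (simp add: add.commute)
  from margin show ?thesis
  proof (elim disjE conjE)
    assume "2 * norm d < q\<^sub>1 - q\<^sub>2"
    then have "\<Phi> (q\<^sub>2 + norm d) < \<Phi> (q\<^sub>1 - norm d)"
      by (intro strict_monoD[OF strict_mono_std_normal_cdf]) simp
    with a b ab show ?thesis
      unfolding compl by simp
  next
    assume r: "0 < r" "r < 1" "\<Phi> q\<^sub>1 \<le> measure std_multi_normal {z. r *\<^sub>R u + z \<in> A}"
      "measure std_multi_normal {z. r *\<^sub>R u + z \<in> B} \<le> \<Phi> q\<^sub>2"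
    have le: "\<Phi> (q\<^sub>2 + norm d) \<le> \<Phi> (q\<^sub>1 - norm d)"
      using d by (simp add: strict_mono_less_eq[OF strict_mono_std_normal_cdf])
    show ?thesis
    \<comment> \<open>The strict cone bound needs a positive quantile. Since
      \<open>q\<^sub>2 < q\<^sub>1\<close>, either \<open>q\<^sub>1\<close> or
      \<open>- q\<^sub>2\<close> is positive, so it applies to \<open>A\<close> or to the complement
      of \<open>B\<close>.\<close>
    proof (cases "0 < q\<^sub>1")
      case True
      have "\<Phi> (q\<^sub>1 - norm d) < measure std_multi_normal {z. u + d + z \<in> A}"
        by (rule neyman_pearson_translation_cone[OF A False cone(1) u(1) r(1-3) True])
      with b ab le show ?thesis
        unfolding compl by simp
    next
      case False
      with q have "0 < - q\<^sub>2" by simp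
      moreover have "\<Phi> (- q\<^sub>2) \<le> measure std_multi_normal {z. r *\<^sub>R u + z \<in> - B}"
        unfolding compl std_normal_cdf_minus using r(4) by simp
      ultimately have "\<Phi> (- q\<^sub>2 - norm d) < measure std_multi_normal {z. u + d + z \<in> - B}"
        using neyman_pearson_translation_cone[OF B'(1) \<open>d \<noteq> 0\<close> B'(2,3) r(1,2)] by blast
      with a ab le show ?thesis
        unfolding compl by simp
    qed
  qed
qed

section \<open>The noise schedule and the certified time range\<close>

lemma measure_isotropic_normal:
  assumes "Y \<in> \<Omega> \<rightarrow>\<^sub>M borel" "distr \<Omega> borel Y = isotropic_normal m v" "A \<in> sets borel"
  shows "\<P>(\<omega> in \<Omega>. Y \<omega> \<in> A) = measure std_multi_normal {z. m + sqrt v *\<^sub>R z \<in> A}"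
proof -
  have "\<P>(\<omega> in \<Omega>. Y \<omega> \<in> A) = measure (distr \<Omega> borel Y) A"
    using assms(1,3) by (simp add: measure_distr vimage_def Int_def conj_commute)
  also have "\<dots> = measure std_multi_normal {z. m + sqrt v *\<^sub>R z \<in> A}"
    unfolding assms(2) isotropic_normal_def using assms(3) by (simp add: measure_distr vimage_def)
  finally show ?thesis .
qed

theorem theorem1:
  fixes h :: "real ^ 'n \<Rightarrow> nat" and K k\<^sub>1 :: nat
    and \<beta>\<^sub>m\<^sub>i\<^sub>n \<beta>\<^sub>m\<^sub>a\<^sub>x :: real and \<beta> \<alpha> :: "real \<Rightarrow> real"
    and x \<epsilon>\<^sub>a\<^sub>d\<^sub>v x\<^sub>a\<^sub>d\<^sub>v :: "real ^ 'n"
    and \<Omega> :: "'w measure" and \<epsilon> :: "'w \<Rightarrow> real ^ 'n"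
    and X \<epsilon>' :: "real \<Rightarrow> 'w \<Rightarrow> real ^ 'n"
    and p\<^sub>1 p\<^sub>2 M t\<^sub>m\<^sub>i\<^sub>n :: real
  assumes classifier: "h \<in> borel \<rightarrow>\<^sub>M count_space {1..K}"
    and scale_invariant: "\<And>c z. c > 0 \<Longrightarrow> h (c *\<^sub>R z) = h z"
    and \<beta>_bounds: "0 < \<beta>\<^sub>m\<^sub>i\<^sub>n" "\<beta>\<^sub>m\<^sub>i\<^sub>n < \<beta>\<^sub>m\<^sub>a\<^sub>x"
    and \<beta>: "\<And>t. \<beta> t = \<beta>\<^sub>m\<^sub>i\<^sub>n + (\<beta>\<^sub>m\<^sub>a\<^sub>x - \<beta>\<^sub>m\<^sub>i\<^sub>n) * t"
    and \<alpha>: "\<And>t. \<alpha> t = exp (- integral {0..t} \<beta>)"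
    and x\<^sub>a\<^sub>d\<^sub>v: "x\<^sub>a\<^sub>d\<^sub>v = x + \<epsilon>\<^sub>a\<^sub>d\<^sub>v"
    and \<Omega>: "prob_space \<Omega>"
    and \<epsilon>: "\<epsilon> \<in> \<Omega> \<rightarrow>\<^sub>M borel" "distr \<Omega> borel \<epsilon> = isotropic_normal 0 1"
    and X: "\<And>t \<omega>. X t \<omega> = sqrt (\<alpha> t) *\<^sub>R x\<^sub>a\<^sub>d\<^sub>v + sqrt (1 - \<alpha> t) *\<^sub>R \<epsilon> \<omega>"
    and \<epsilon>': "\<And>t. t \<in> {0..1} \<Longrightarrow> \<epsilon>' t \<in> \<Omega> \<rightarrow>\<^sub>M borel"
      "\<And>t. t \<in> {0..1} \<Longrightarrow> distr \<Omega> borel (\<epsilon>' t) = isotropic_normal 0 ((1 - \<alpha> t) / \<alpha> t)"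
    and p: "p\<^sub>1 \<in> {0<..<1}" "p\<^sub>2 \<in> {0<..<1}" "p\<^sub>1 > p\<^sub>2"
    and k\<^sub>1: "k\<^sub>1 \<in> {1..K}"
    and top_class: "\<And>t. t \<in> {0..1} \<Longrightarrow> \<P>(\<omega> in \<Omega>. h (x + \<epsilon>' t \<omega>) = k\<^sub>1) \<ge> p\<^sub>1"
    and other_classes: "\<And>t k. t \<in> {0..1} \<Longrightarrow> k \<in> {1..K} - {k\<^sub>1} \<Longrightarrow>
      p\<^sub>2 \<ge> \<P>(\<omega> in \<Omega>. h (x + \<epsilon>' t \<omega>) = k)"
    and M: "M = ln (1 +
      (2 * norm \<epsilon>\<^sub>a\<^sub>d\<^sub>v / (std_normal_quantile p\<^sub>1 - std_normal_quantile p\<^sub>2))\<^sup>2)"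
    and t\<^sub>m\<^sub>i\<^sub>n: "t\<^sub>m\<^sub>i\<^sub>n = 2 * M /
      (sqrt (\<beta>\<^sub>m\<^sub>i\<^sub>n\<^sup>2 + 2 * (\<beta>\<^sub>m\<^sub>a\<^sub>x - \<beta>\<^sub>m\<^sub>i\<^sub>n) * M) + \<beta>\<^sub>m\<^sub>i\<^sub>n)"
    and "\<beta>\<^sub>m\<^sub>i\<^sub>n \<ge> M"
  shows "\<forall>t. t\<^sub>m\<^sub>i\<^sub>n \<le> t \<and> t \<le> 1 \<longrightarrow>
    {k. is_arg_max (\<lambda>k. \<P>(\<omega> in \<Omega>. h (X t \<omega>) = k)) (\<lambda>k. k \<in> {1..K}) k} = {k\<^sub>1}"
proof (intro allI impI)
  fix t assume t: "t\<^sub>m\<^sub>i\<^sub>n \<le> t \<and> t \<le> 1"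
  define q\<^sub>1 where "q\<^sub>1 = std_normal_quantile p\<^sub>1"
  define q\<^sub>2 where "q\<^sub>2 = std_normal_quantile p\<^sub>2"
  define c where "c = \<beta>\<^sub>m\<^sub>a\<^sub>x - \<beta>\<^sub>m\<^sub>i\<^sub>n"
  \<comment> \<open>\<open>B t\<close> is the integral of \<beta> up to \<open>t\<close>, and
    \<open>s t\<close> below is the noise variance
    \<open>(1 - \<alpha> t) / \<alpha> t\<close>.\<close>
  define B where "B t = \<beta>\<^sub>m\<^sub>i\<^sub>n * t + c * t\<^sup>2 / 2" for t
  define s where "s t = exp (B t) - 1" for t
  have quantile: "\<Phi> q\<^sub>1 = p\<^sub>1" "\<Phi> q\<^sub>2 = p\<^sub>2"
    using p by (simp_all add: q\<^sub>1_def q\<^sub>2_def std_normal_cdf_quantile)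
  then have q: "q\<^sub>2 < q\<^sub>1"
    using p(3) strict_mono_less[OF strict_mono_std_normal_cdf, of q\<^sub>2 q\<^sub>1] by simp
  have c: "0 < c"
    using \<beta>_bounds by (simp add: c_def)
  have B_mono: "B t < B t'" if "0 \<le> t" "t < t'" for t t'
    using that \<beta>_bounds c unfolding B_def
    by (intro add_strict_mono mult_strict_left_mono divide_strict_right_mono power_strict_mono) auto
  have M_def: "M = ln (1 + (2 * norm \<epsilon>\<^sub>a\<^sub>d\<^sub>v / (q\<^sub>1 - q\<^sub>2))\<^sup>2)"
    by (simp add: M q\<^sub>1_def q\<^sub>2_def)
  have exp_M: "exp M = 1 + (2 * norm \<epsilon>\<^sub>a\<^sub>d\<^sub>v / (q\<^sub>1 - q\<^sub>2))\<^sup>2"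
    unfolding M_def by (rule exp_ln) (simp add: add_pos_nonneg)
  have "0 \<le> M"
    unfolding M_def by simp
  \<comment> \<open>\<open>D\<close> is the root of the discriminant of the quadratic equation
    \<open>B t = M\<close>. Its nonnegative solution
    \<open>(D - \<beta>\<^sub>m\<^sub>i\<^sub>n) / c\<close> is
    \<open>t\<^sub>m\<^sub>i\<^sub>n\<close> after rationalizing.\<close>
  define D where "D = sqrt (\<beta>\<^sub>m\<^sub>i\<^sub>n\<^sup>2 + 2 * c * M)"
  have D: "0 \<le> D" "D\<^sup>2 = \<beta>\<^sub>m\<^sub>i\<^sub>n\<^sup>2 + 2 * c * M"
    using c \<open>0 \<le> M\<close> by (simp_all add: D_def)
  have t_min: "t\<^sub>m\<^sub>i\<^sub>n = 2 * M / (D + \<beta>\<^sub>m\<^sub>i\<^sub>n)"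
    by (simp add: t\<^sub>m\<^sub>i\<^sub>n D_def c_def)
  have "0 \<le> t\<^sub>m\<^sub>i\<^sub>n"
    using D(1) \<beta>_bounds \<open>0 \<le> M\<close> by (simp add: t_min)
  with t have t01: "t \<in> {0..1}" by simp
  have "c * t\<^sub>m\<^sub>i\<^sub>n = (D\<^sup>2 - \<beta>\<^sub>m\<^sub>i\<^sub>n\<^sup>2) / (D + \<beta>\<^sub>m\<^sub>i\<^sub>n)"
    unfolding D(2) by (simp add: t_min)
  also have "\<dots> = D - \<beta>\<^sub>m\<^sub>i\<^sub>n"
    using D(1) \<beta>_bounds by (simp add: field_simps power2_eq_square)
  finally have D_eq: "D = c * t\<^sub>m\<^sub>i\<^sub>n + \<beta>\<^sub>m\<^sub>i\<^sub>n"
    by simp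
  have "B t\<^sub>m\<^sub>i\<^sub>n = t\<^sub>m\<^sub>i\<^sub>n * (D + \<beta>\<^sub>m\<^sub>i\<^sub>n) / 2"
    unfolding D_eq B_def by (simp add: power2_eq_square field_simps)
  also have "\<dots> = M"
    using D(1) \<beta>_bounds by (simp add: t_min)
  finally have B_t_min: "B t\<^sub>m\<^sub>i\<^sub>n = M" .
  have M_le: "M \<le> B t"
    using B_mono[of "t\<^sub>m\<^sub>i\<^sub>n" t] B_t_min \<open>0 \<le> t\<^sub>m\<^sub>i\<^sub>n\<close> t by (cases "t = t\<^sub>m\<^sub>i\<^sub>n") auto
  \<comment> \<open>The slope term adds \<open>c / 2\<close> to
    \<open>\<beta>\<^sub>m\<^sub>i\<^sub>n\<close>, so the inequality is strict even if
    \<open>\<beta>\<^sub>m\<^sub>i\<^sub>n = M\<close>. This leaves room above the critical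
    time.\<close>
  have M_less: "M < B 1"
    using \<open>\<beta>\<^sub>m\<^sub>i\<^sub>n \<ge> M\<close> c by (simp add: B_def)
  have \<alpha>_eq: "\<alpha> t = exp (- B t)" if "0 \<le> t" for t
  proof -
    have "(\<beta> has_integral B t - B 0) {0..t}"
      using that unfolding B_def
      by (intro fundamental_theorem_of_calculus)
        (auto intro!: derivative_eq_intros simp: \<beta> c_def simp flip: has_real_derivative_iff_has_vector_derivative)
    then show ?thesis
      unfolding \<alpha> by (simp add: integral_unique B_def)
  qed
  have s_eq: "(1 - \<alpha> t) / \<alpha> t = s t" if "0 \<le> t" for t
    by (simp add: \<alpha>_eq[OF that] s_def exp_minus field_simps)
  have s_nonneg: "0 \<le> s t" if "0 \<le> t" for t
    using B_mono[of 0 t] that by (cases "t = 0") (auto simp: s_def B_def)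
  have h_in: "h z \<in> {1..K}" for z
    using measurable_space[OF classifier, of z] by simp
  have meas: "h -` {k} \<in> sets borel" for k
  proof -
    have "h -` ({k} \<inter> {1..K}) \<inter> space borel \<in> sets borel"
      by (rule measurable_sets[OF classifier]) simp
    moreover have "h -` ({k} \<inter> {1..K}) \<inter> space borel = h -` {k}"
      using h_in by auto
    ultimately show ?thesis by simp
  qed
  have cone: "c *\<^sub>R z \<in> h -` {k} \<longleftrightarrow> z \<in> h -` {k}" if "c > 0" for c z k
    using that by (simp add: scale_invariant)
  have shift: "{z. y + a *\<^sub>R z \<in> h -` {k}} \<in> sets borel" for y a k
    using measurable_sets_borel[OF _ meas, of "\<lambda>z. y + a *\<^sub>R z"] by (simp add: vimage_def)
  have noisy: "\<P>(\<omega> in \<Omega>. h (x + \<epsilon>' t \<omega>) = k) = measure std_multi_normal {z. x + sqrt (s t) *\<^sub>R z \<in> h -` {k}}"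
    if "t \<in> {0..1}" for t k
    using measure_isotropic_normal[OF \<epsilon>'[OF that] shift[of x 1 k]] that by (simp add: s_eq)
  have adv: "\<P>(\<omega> in \<Omega>. h (X t \<omega>) = k) =
      measure std_multi_normal {z. x\<^sub>a\<^sub>d\<^sub>v + sqrt (s t) *\<^sub>R z \<in> h -` {k}}" for k
  proof -
    have "0 < \<alpha> t" "0 \<le> t"
      using t01 by (simp_all add: \<alpha>_eq)
    then have "X t \<omega> = sqrt (\<alpha> t) *\<^sub>R (x\<^sub>a\<^sub>d\<^sub>v + sqrt (s t) *\<^sub>R \<epsilon> \<omega>)" for \<omega>
      by (simp add: X scaleR_add_right s_eq[symmetric] real_sqrt_divide)
    with \<open>0 < \<alpha> t\<close> have "h (X t \<omega>) = h (x\<^sub>a\<^sub>d\<^sub>v + sqrt (s t) *\<^sub>R \<epsilon> \<omega>)" for \<omega>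
      by (simp add: scale_invariant)
    then show ?thesis
      using measure_isotropic_normal[OF \<epsilon> shift[of x\<^sub>a\<^sub>d\<^sub>v "sqrt (s t)" k]] by simp
  qed
  have less: "\<P>(\<omega> in \<Omega>. h (X t \<omega>) = k) < \<P>(\<omega> in \<Omega>. h (X t \<omega>) = k\<^sub>1)" if k: "k \<in> {1..K} - {k\<^sub>1}" for k
  \<comment> \<open>Without a perturbation \<open>t = 0\<close> is admissible and the noise may
    vanish, so no rescaling is possible; the hypotheses on \<open>x\<close> then apply directly.
    Otherwise \<open>M\<close>, \<open>t\<close> and \<open>s t\<close> are positive.\<close>
  proof (cases "\<epsilon>\<^sub>a\<^sub>d\<^sub>v = 0")
    case True
    then show ?thesis
      using top_class[OF t01] other_classes[OF t01 k] p(3) unfolding adv noisy[OF t01] x\<^sub>a\<^sub>d\<^sub>v by simp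
  next
    case False
    have "0 < (2 * norm \<epsilon>\<^sub>a\<^sub>d\<^sub>v / (q\<^sub>1 - q\<^sub>2))\<^sup>2"
      using False q by simp
    then have "0 < M"
      using exp_M by (metis less_add_same_cancel1 one_less_exp_iff)
    then have "0 < t\<^sub>m\<^sub>i\<^sub>n"
      using D(1) \<beta>_bounds by (simp add: t_min)
    with t have "0 < t"
      by simp
    have s_pos: "0 < s t" if "0 < t" for t
      using B_mono[of 0 t] that by (simp add: s_def B_def)
    \<comment> \<open>Dividing by the noise level makes the noise standard, and the cone property of
      the classes leaves their probabilities unchanged. Different times now differ only in the
      length of the base point.\<close>
    define u where "u t = x /\<^sub>R sqrt (s t)" for t
    define d where "d = \<epsilon>\<^sub>a\<^sub>d\<^sub>v /\<^sub>R sqrt (s t)"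
    have rescale: "{z. y + sqrt (s t) *\<^sub>R z \<in> h -` {k}} = {z. y /\<^sub>R sqrt (s t) + z \<in> h -` {k}}"
      if "0 < t" for t k and y :: "real ^ 'n"
    proof -
      have "y + sqrt (s t) *\<^sub>R z = sqrt (s t) *\<^sub>R (y /\<^sub>R sqrt (s t) + z)" for z
        using s_pos[OF that] by (simp add: scaleR_add_right)
      then show ?thesis
        using cone[of "sqrt (s t)"] s_pos[OF that] by simp
    qed
    have noisy_u: "\<Phi> q\<^sub>1 \<le> measure std_multi_normal {z. u t + z \<in> h -` {k\<^sub>1}}"
      "measure std_multi_normal {z. u t + z \<in> h -` {k}} \<le> \<Phi> q\<^sub>2" if "0 < t" "t \<le> 1" for t
      using top_class[of t] other_classes[of t k] k that
      by (simp_all only: noisy rescale u_def quantile atLeastAtMost_iff less_imp_le simp_thms)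
    have radius: "2 * norm \<epsilon>\<^sub>a\<^sub>d\<^sub>v / (q\<^sub>1 - q\<^sub>2) = sqrt (exp M - 1)"
      using q by (simp add: exp_M)
    \<comment> \<open>As \<open>s t = exp (B t) - 1\<close>, the root is at most 1 because
      \<open>M \<le> B t\<close>.\<close>
    have norm_d: "2 * norm d = sqrt ((exp M - 1) / s t) * (q\<^sub>1 - q\<^sub>2)"
      using radius q s_pos[OF \<open>0 < t\<close>] by (simp add: d_def real_sqrt_divide field_simps)
    have "2 * norm d \<le> q\<^sub>1 - q\<^sub>2"
      unfolding norm_d using M_le q s_pos[OF \<open>0 < t\<close>] by (simp add: s_def)
    \<comment> \<open>At \<open>t = 1\<close> the margin is strict by \<open>M < B 1\<close>.
      Earlier, the ratio of noise levels shrinks \<open>u t\<close> to \<open>u 1\<close>, where the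
      hypotheses at time 1 supply the bounds.\<close>
    moreover have "2 * norm d < q\<^sub>1 - q\<^sub>2 \<or> 0 < sqrt (s t / s 1) \<and> sqrt (s t / s 1) < 1 \<and>
      \<Phi> q\<^sub>1 \<le> measure std_multi_normal {z. sqrt (s t / s 1) *\<^sub>R u t + z \<in> h -` {k\<^sub>1}} \<and>
      measure std_multi_normal {z. sqrt (s t / s 1) *\<^sub>R u t + z \<in> h -` {k}} \<le> \<Phi> q\<^sub>2"
    proof (cases "t = 1")
      case True
      have "2 * norm d < q\<^sub>1 - q\<^sub>2"
        unfolding norm_d using True M_less q s_pos[of 1] by (simp add: s_def)
      then show ?thesis ..
    next
      case False
      have "s t < s 1"
        using B_mono[of t 1] False t \<open>0 < t\<close> by (simp add: s_def)
      moreover have "sqrt (s t / s 1) *\<^sub>R u t = u 1"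
        using s_pos[of 1] s_pos[OF \<open>0 < t\<close>] by (simp add: u_def real_sqrt_divide field_simps)
      ultimately show ?thesis
        using noisy_u[of 1] s_pos[of 1] s_pos[OF \<open>0 < t\<close>] by simp
    qed
    ultimately have "measure std_multi_normal {z. u t + d + z \<in> h -` {k}}
        < measure std_multi_normal {z. u t + d + z \<in> h -` {k\<^sub>1}}"
      using t[THEN conjunct2] \<open>0 < t\<close>
      by (intro cone_probability_less[OF meas meas cone cone q _ noisy_u, where r = "sqrt (s t / s 1)"])
    then show ?thesis
      unfolding adv rescale[OF \<open>0 < t\<close>] x\<^sub>a\<^sub>d\<^sub>v u_def d_def scaleR_add_right .
  qed
  show "{k. is_arg_max (\<lambda>k. \<P>(\<omega> in \<Omega>. h (X t \<omega>) = k)) (\<lambda>k. k \<in> {1..K}) k} = {k\<^sub>1}"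
    using k\<^sub>1 less unfolding is_arg_max_def by (fastforce dest: less_not_sym)
qed

end
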